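(* Let $D=(V,E)$ be a finite strongly connected digraph without loops. Then the strongly biconnected components of $D$ are exactly the induced sub-digraphs $D[V(B)]$, where $B$ ranges over the biconnected components of the underlying graph $\mathcal{G}(D)$.
   Context: $\mathcal{G}(D)$ is the undirected graph on $V$ with edges $\{v,w\}$ for $(v,w)\in E$. A graph is biconnected if it is connected and has no cut vertex (a vertex whose removal increases the number of connected components); the one-vertex graph is biconnected; biconnected components are maximal biconnected subgraphs. A digraph is strongly biconnected if it is strongly connected and its underlying graph is biconnected (the one-vertex digraph with no arcs is strongly biconnected); the strongly biconnected components of $D$ are its maximal strongly biconnected sub-digraphs. $D[X]$ denotes the sub-digraph $(X,E\cap X\times X)$. *)

theory Defs
  imports "Graph_Theory.Digraph_Component"
begin

text \<open>
  As in the Graph_Theory entry, an undirected simple graph is a finite symmetric loop-free digraph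
  without parallel arcs (locale \<^term>\<open>graph\<close>): the edge \<open>{v, w}\<close> is the pair of arcs
  \<open>(v, w)\<close>, \<open>(w, v)\<close>, the undirected subgraphs are the symmetric subgraphs, and the underlying
  undirected graph of a digraph is given by \<^term>\<open>mk_symmetric\<close>. Note that
  \<^term>\<open>connected\<close> disregards arc directions, and that \<^term>\<open>connected\<close> and
  \<^term>\<open>strongly_connected\<close> exclude the null graph.
\<close>

definition components :: "('a, 'b) pre_digraph \<Rightarrow> ('a, 'b) pre_digraph set" where
  "components G = {C. pre_digraph.max_subgraph G connected C}"

text \<open>
  \<^term>\<open>card\<close> is a genuine count here, since cut vertices are only considered in finite graphs.
\<close>

definition cut_vertex :: "('a, 'b) pre_digraph \<Rightarrow> 'a \<Rightarrow> bool" where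
  "cut_vertex G v \<longleftrightarrow>
     v \<in> verts G \<and> card (components G) < card (components (pre_digraph.del_vert G v))"

text \<open>
  Deleting the only vertex of a graph leaves no component at all, so the one-vertex graph
  has no cut vertex and is biconnected without a separate clause.
\<close>

definition biconnected :: "('a, 'b) pre_digraph \<Rightarrow> bool" where
  "biconnected G \<longleftrightarrow> graph G \<and> connected G \<and> (\<nexists>v. cut_vertex G v)"

definition biconnected_components :: "('a, 'b) pre_digraph \<Rightarrow> ('a, 'b) pre_digraph set" where
  "biconnected_components G = {B. pre_digraph.max_subgraph G biconnected B}"

definition strongly_biconnected :: "('a, 'b) pre_digraph \<Rightarrow> bool" where
  "strongly_biconnected D \<longleftrightarrow> strongly_connected D \<and> biconnected (with_proj (mk_symmetric D))"

definition strongly_biconnected_components ::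
  "('a, 'b) pre_digraph \<Rightarrow> ('a, 'b) pre_digraph set" where
  "strongly_biconnected_components D = {H. pre_digraph.max_subgraph D strongly_biconnected H}"

end

theory Submission
  imports Defs
begin

text \<open>
  Let \<open>X\<close> be the vertex set of a biconnected component. Adding to \<open>X\<close> an ear, that is a path outside
  \<open>X\<close> joining two distinct vertices of \<open>X\<close>, preserves biconnectedness, so by maximality no ear exists.
  Hence a directed walk between two vertices of \<open>X\<close> can return to \<open>X\<close> only at the vertex where it left,
  and cutting out these excursions shows that \<open>D[X]\<close> is strongly connected. Both kinds of components
  are therefore induced by the same vertex sets.
\<close>

section \<open>Connectivity of vertex sets: strong for directed arcs, ordinary for a symmetric
  relation\<close>

definition connected_in :: "'a rel \<Rightarrow> 'a set \<Rightarrow> bool" where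
  "connected_in R X \<longleftrightarrow> (\<forall>a\<in>X. \<forall>b\<in>X. (a, b) \<in> (Restr R X)\<^sup>*)"

text \<open>The empty set is \<open>connected_in\<close> every relation, so a singleton passes the
  deletion test. The empty set passes it too, which is why nonemptiness is demanded separately
  below.\<close>

definition biconnected_in :: "'a rel \<Rightarrow> 'a set \<Rightarrow> bool" where
  "biconnected_in R X \<longleftrightarrow> connected_in R X \<and> (\<forall>v. connected_in R (X - {v}))"

definition maximal_in :: "('a set \<Rightarrow> bool) \<Rightarrow> 'a set \<Rightarrow> 'a set \<Rightarrow> bool" where
  "maximal_in Q V X \<longleftrightarrow> X \<subseteq> V \<and> Q X \<and> (\<forall>Y. X \<subseteq> Y \<and> Y \<subseteq> V \<and> Q Y \<longrightarrow> Y = X)"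

lemma connected_in_mono: "connected_in R X \<Longrightarrow> R \<subseteq> S \<Longrightarrow> connected_in S X"
  unfolding connected_in_def by (meson Int_mono order_refl rtrancl_mono subsetD)

lemma biconnected_in_mono: "biconnected_in R X \<Longrightarrow> R \<subseteq> S \<Longrightarrow> biconnected_in S X"
  unfolding biconnected_in_def by (blast intro: connected_in_mono)

lemma connected_in_Restr: "X \<subseteq> Y \<Longrightarrow> connected_in (Restr R Y) X \<longleftrightarrow> connected_in R X"
proof -
  assume "X \<subseteq> Y"
  then have "Restr (Restr R Y) X = Restr R X" by blast
  then show ?thesis by (simp add: connected_in_def)
qed

lemma biconnected_in_Restr: "biconnected_in (Restr R X) X \<longleftrightarrow> biconnected_in R X"
  by (simp add: biconnected_in_def connected_in_Restr)

lemma connected_in_insert: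
  assumes "connected_in R A" "sym R" "a \<in> A" "(a, b) \<in> R"
  shows "connected_in R (insert b A)"
proof -
  let ?S = "Restr R (insert b A)"
  have "Restr R A \<subseteq> ?S" by blast
  then have A: "(u, v) \<in> ?S\<^sup>*" if "u \<in> A" "v \<in> A" for u v
    using that assms(1) rtrancl_mono unfolding connected_in_def by blast
  have ab: "(a, b) \<in> ?S" "(b, a) \<in> ?S" using assms by (auto dest: symD)
  have to: "(u, b) \<in> ?S\<^sup>*" if "u \<in> insert b A" for u
    using A[of u a] that ab assms(3) by (auto intro: rtrancl_into_rtrancl)
  have "(b, v) \<in> ?S\<^sup>*" if "v \<in> insert b A" for v
    using A[of a v] that ab assms(3) by (auto intro: converse_rtrancl_into_rtrancl)
  with to show ?thesis unfolding connected_in_def by (blast intro: rtrancl_trans)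
qed

text \<open>The path is absorbed vertex by vertex, each new vertex being adjacent to one already in
  the set. Only its start is tied to \<open>A\<close>, so a path hanging loose at the other end is
  covered.\<close>

lemma connected_in_Un_path:
  assumes "connected_in R A" "sym R" "a \<in> A" "successively (\<lambda>u v. (u, v) \<in> R) (a # p)"
  shows "connected_in R (A \<union> set p)"
  using assms
proof (induction p arbitrary: a A)
  case (Cons b p)
  then have "connected_in R (insert b A)" by (auto intro: connected_in_insert)
  with Cons.IH[of "insert b A" b] Cons.prems show ?case by simp
qed simp

section \<open>Paths, ears and excursions\<close>

lemma rtrancl_imp_path:
  assumes "(u, v) \<in> R\<^sup>*"
  obtains p where "p \<noteq> []" "hd p = u" "last p = v" "distinct p"
    "successively (\<lambda>a b. (a, b) \<in> R) p"
proof -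
  from assms have "\<exists>p. p \<noteq> [] \<and> hd p = u \<and> last p = v \<and> distinct p \<and>
    successively (\<lambda>a b. (a, b) \<in> R) p"
  proof (induction rule: converse_rtrancl_induct)
    case base
    show ?case by (rule exI[of _ "[v]"]) simp
  next
    case (step x y)
    then obtain p where p: "p \<noteq> []" "hd p = y" "last p = v" "distinct p"
      "successively (\<lambda>a b. (a, b) \<in> R) p" by blast
    show ?case
    proof (cases "x \<in> set p")
      case True
      \<comment> \<open>A new vertex already on the path closes a cycle; keeping only the suffix
        from \<open>x\<close> removes it.\<close>
      then obtain q r where "p = q @ x # r" by (auto dest: split_list)
      with p show ?thesis
        by (intro exI[of _ "x # r"]) (auto simp: successively_append_iff)
    next
      case False
      with p step show ?thesis
        by (intro exI[of _ "x # p"]) (auto simp: successively_Cons)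
    qed
  qed
  with that show ?thesis by blast
qed

text \<open>Deleting a vertex of the ear leaves two pieces, each attached to the intact
  \<open>X\<close> at its own end. Deleting any other vertex spares \<open>x\<close> or
  \<open>y\<close>, and the whole ear hangs from that end.\<close>

lemma biconnected_in_Un_ear:
  assumes bi: "biconnected_in R X" and "sym R" and xy: "x \<in> X" "y \<in> X" "x \<noteq> y"
    and p: "successively (\<lambda>u v. (u, v) \<in> R) (x # p @ [y])" "distinct p" "set p \<inter> X = {}"
  shows "biconnected_in R (X \<union> set p)"
proof -
  let ?path = "successively (\<lambda>u v. (u, v) \<in> R)"
  have conn: "connected_in R X" "\<And>v. connected_in R (X - {v})"
    using bi by (auto simp: biconnected_in_def)
  have sym: "(\<lambda>u v. (v, u) \<in> R) = (\<lambda>u v. (u, v) \<in> R)"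
    using \<open>sym R\<close> by (auto simp: fun_eq_iff dest: symD)
  have "?path (rev (x # p @ [y]))" using p(1) by (simp only: successively_rev sym)
  then have rp: "?path (y # rev p @ [x])" by simp
  \<comment> \<open>Passing to a prefix detaches the far end, so that each piece is held by one end
    only.\<close>
  have pre: "?path (u # q)" if "?path (u # q @ r)" for u q r
    using that by (metis append_Cons successively_append_iff)
  have "connected_in R (X \<union> set p - {v})" for v
  proof (cases "v \<in> set p")
    case True
    then obtain q r where qr: "p = q @ v # r" by (auto dest: split_list)
    then have q: "?path (x # q)" using pre[of x q "v # r @ [y]"] p(1) by simp
    \<comment> \<open>The part beyond \<open>v\<close> is read backwards so that it starts at
      \<open>y\<close>.\<close>
    have r: "?path (y # rev r)" using pre[of y "rev r" "v # rev q @ [x]"] rp qr by simp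
    have "connected_in R ((X \<union> set q) \<union> set (rev r))"
      using \<open>sym R\<close> q r xy conn by (intro connected_in_Un_path[of _ _ y] connected_in_Un_path[of _ _ x]) auto
    moreover have "X \<union> set p - {v} = (X \<union> set q) \<union> set (rev r)"
      using p qr True by auto
    ultimately show ?thesis by simp
  next
    case False
    have "connected_in R (X - {v} \<union> set p)"
    proof (cases "v = x")
      case True
      with \<open>sym R\<close> xy pre[OF rp] conn(2) have "connected_in R (X - {v} \<union> set (rev p))"
        by (intro connected_in_Un_path[of _ _ y]) auto
      then show ?thesis by simp
    next
      case False
      with \<open>sym R\<close> xy pre[OF p(1)] conn(2) show ?thesis
        by (intro connected_in_Un_path[of _ _ x]) auto
    qed
    with False show ?thesis by (simp add: Un_Diff)
  qed
  moreover have "connected_in R (X \<union> set p)"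
    using \<open>sym R\<close> xy pre[OF p(1)] conn(1) by (intro connected_in_Un_path[of _ _ x]) auto
  ultimately show ?thesis by (simp add: biconnected_in_def)
qed

text \<open>If an excursion out of \<open>X\<close> came back at a different vertex, a path without
  repetitions extracted from it would be an ear, and adding it would enlarge
  \<open>X\<close>.\<close>

lemma maximal_biconnected_in_no_ear:
  assumes max: "maximal_in (\<lambda>Y. Y \<noteq> {} \<and> biconnected_in R Y) V X"
    and "sym R" "R \<subseteq> V \<times> V" "x \<in> X" "y \<in> X"
    and ear: "(x, c) \<in> R" "c \<notin> X" "(c, z) \<in> (Restr R (- X))\<^sup>*" "(z, y) \<in> R"
  shows "x = y"
proof (rule ccontr)
  assume "x \<noteq> y"
  obtain p where p: "p \<noteq> []" "hd p = c" "last p = z" "distinct p"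
    "successively (\<lambda>a b. (a, b) \<in> Restr R (- X)) p"
    using rtrancl_imp_path[OF ear(3)] .
  \<comment> \<open>For a one-vertex path the relation says nothing about \<open>c\<close>, so the
    entering edge \<open>(x, c)\<close> and \<open>c \<notin> X\<close> take part in the induction;
    each further vertex is entered from its predecessor.\<close>
  have "set p \<subseteq> V - X"
    using p(1,2,5) ear(1,2)
  proof (induction p arbitrary: x c)
    case (Cons b p)
    with assms(3) show ?case by (cases p) auto
  qed simp
  moreover have "successively (\<lambda>u v. (u, v) \<in> R) p"
    by (rule successively_mono[OF p(5)]) simp
  with p ear have "successively (\<lambda>u v. (u, v) \<in> R) (x # p @ [y])"
    by (auto simp: successively_append_iff successively_Cons)
  ultimately have "biconnected_in R (X \<union> set p)" "X \<union> set p \<subseteq> V"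
    using max assms \<open>x \<noteq> y\<close> p(4)
    by (auto simp: maximal_in_def intro!: biconnected_in_Un_ear[of _ _ x y])
  with max have "X \<union> set p = X" by (auto simp: maximal_in_def)
  with p ear(2) show False by (auto dest: hd_in_set)
qed

lemma connected_in_maximal_biconnected_in:
  assumes max: "maximal_in (\<lambda>Y. Y \<noteq> {} \<and> biconnected_in (E \<union> E\<inverse>) Y) V X"
    and "E \<subseteq> V \<times> V" "connected_in E V"
  shows "connected_in E X"
  unfolding connected_in_def
proof (intro ballI)
  let ?R = "E \<union> E\<inverse>"
  fix u v assume uv: "u \<in> X" "v \<in> X"
  with max have "u \<in> V" "v \<in> V" by (auto simp: maximal_in_def)
  with assms(3) have "(u, v) \<in> (Restr E V)\<^sup>*" by (simp add: connected_in_def)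
  then have "(u, v) \<in> E\<^sup>*" using rtrancl_mono[of "Restr E V" E] by auto
  \<comment> \<open>Invariant at the current end of the walk: inside \<open>X\<close>, it is reached
    within \<open>X\<close>; outside, the exit vertex \<open>x\<close> is remembered together with
    the excursion since then. The excursion is recorded in \<open>?R\<close>, the symmetric relation
    in which ears are excluded.\<close>
  then have "if v \<in> X then (u, v) \<in> (Restr E X)\<^sup>*
    else \<exists>x\<in>X. \<exists>c. c \<notin> X \<and> (u, x) \<in> (Restr E X)\<^sup>* \<and> (x, c) \<in> E \<and> (c, v) \<in> (Restr ?R (- X))\<^sup>*"
    (is "?P v")
  proof (induction rule: rtrancl_induct)
    case base
    with uv show ?case by simp
  next
    case (step y z)
    show ?case
    proof (cases "y \<in> X")
      case True
      with step show ?thesis by (auto intro: rtrancl_into_rtrancl)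
    next
      case False
      with step obtain x c where xc: "x \<in> X" "c \<notin> X" "(u, x) \<in> (Restr E X)\<^sup>*" "(x, c) \<in> E"
        "(c, y) \<in> (Restr ?R (- X))\<^sup>*" by auto
      show ?thesis
      proof (cases "z \<in> X")
        case True
        \<comment> \<open>The walk re-enters \<open>X\<close> at \<open>z\<close>. Without ears this
          is the exit vertex, so the excursion is discarded.\<close>
        have "x = z"
          using max _ _ \<open>x \<in> X\<close> True _ \<open>c \<notin> X\<close> xc(5)
        proof (rule maximal_biconnected_in_no_ear)
          show "sym ?R" by (auto intro: symI)
        qed (use xc step assms(2) in auto)
        with xc True show ?thesis by simp
      next
        case False
        with \<open>y \<notin> X\<close> step have "(y, z) \<in> Restr ?R (- X)" by simp
        with xc False show ?thesis by (auto intro: rtrancl_into_rtrancl)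
      qed
    qed
  qed
  with uv show "(u, v) \<in> (Restr E X)\<^sup>*" by simp
qed

section \<open>Maximal subgraphs as induced subgraphs on maximal vertex sets\<close>

lemma (in wf_digraph) max_subgraphs_eq_induce_maximal:
  assumes "finite (verts G)"
    and sub: "\<And>H. subgraph H G \<Longrightarrow> P H \<Longrightarrow> Q (verts H)"
    and ind: "\<And>X. maximal_in Q (verts G) X \<Longrightarrow> P (G \<restriction> X)"
  shows "{H. max_subgraph P H} = {G \<restriction> X | X. maximal_in Q (verts G) X}"
\<comment> \<open>\<open>ind\<close> concerns maximal sets only, with strong biconnectedness in
  mind: a smaller set that is biconnected in the underlying graph, such as two vertices of a
  directed triangle, need not induce a strongly connected sub-digraph.\<close>
proof (intro equalityI subsetI)
  fix H assume "H \<in> {H. max_subgraph P H}"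
  then have H: "subgraph H G" "P H" "max_subgraph P H" by (auto simp: max_subgraph_def)
  \<comment> \<open>By finiteness \<open>verts H\<close> extends to a maximal \<open>Q\<close>-set
    \<open>X\<close>; then \<open>G \<restriction> X\<close> satisfies \<open>P\<close> and contains
    \<open>H\<close>, so maximality of \<open>H\<close> forces equality.\<close>
  let ?C = "{Y. verts H \<subseteq> Y \<and> Y \<subseteq> verts G \<and> Q Y}"
  have "finite ?C" by (rule finite_subset[of _ "Pow (verts G)"]) (auto simp: assms(1))
  moreover have "verts H \<in> ?C" using H sub by auto
  ultimately obtain X where X: "X \<in> ?C" "\<And>Y. Y \<in> ?C \<Longrightarrow> X \<subseteq> Y \<Longrightarrow> X = Y"
    using finite_has_maximal[of ?C] by (metis (no_types, lifting) empty_iff)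
  then have maxX: "maximal_in Q (verts G) X" by (auto simp: maximal_in_def)
  interpret H: wf_digraph H using H(1) by auto
  have "tail H = tail G" "head H = head G" using H(1) by (auto simp: compatible_def)
  then have "subgraph H (G \<restriction> X)"
    using H(1) X(1) H.wellformed
    by (intro subgraphI) (auto simp: compatible_def intro: H.wf_digraph)
  moreover have "subgraph (G \<restriction> X) G" using X by (auto intro: subgraph_induce_subgraphI)
  ultimately have "H = G \<restriction> X" using H(3) ind[OF maxX] by (auto simp: max_subgraph_def)
  with maxX show "H \<in> {G \<restriction> X | X. maximal_in Q (verts G) X}" by blast
next
  fix H assume "H \<in> {G \<restriction> X | X. maximal_in Q (verts G) X}"
  then obtain X where X: "H = G \<restriction> X" "maximal_in Q (verts G) X" by blast
  have "max_subgraph P (G \<restriction> X)"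
  proof (rule max_subgraphI)
    show "P (G \<restriction> X)" by (rule ind) fact
    show "subgraph (G \<restriction> X) G"
      using X by (auto simp: maximal_in_def intro: subgraph_induce_subgraphI)
    fix H' assume H': "G \<restriction> X \<noteq> H'" "subgraph (G \<restriction> X) H'" "subgraph H' G"
    show "\<not> P H'"
    proof
      assume "P H'"
      with H' sub have "Q (verts H')" "X \<subseteq> verts H'" "verts H' \<subseteq> verts G"
        by (auto simp: subgraph_def)
      with X have "verts H' = X" by (auto simp: maximal_in_def)
      with H' have "subgraph H' (G \<restriction> X)" using subgraph_induce_subgraphI2 by blast
      with H' \<open>verts H' = X\<close> have "G \<restriction> X = H'"
        by (intro pre_digraph.equality) (auto simp: subgraph_def compatible_def)
      with H' show False by simp
    qed
  qed
  with X show "H \<in> {H. max_subgraph P H}" by simp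
qed

section \<open>Connectivity, components and cut vertices of graphs in terms of vertex sets\<close>

lemma (in wf_digraph) strongly_connected_induce_iff:
  "strongly_connected (G \<restriction> X) \<longleftrightarrow> X \<noteq> {} \<and> connected_in (arcs_ends G) X"
proof -
  interpret X: wf_digraph "G \<restriction> X" by rule
  have "arcs_ends (G \<restriction> X) = Restr (arcs_ends G) X"
    by (auto simp: arcs_ends_conv)
  then show ?thesis
    by (simp add: strongly_connected_def connected_in_def X.reachable_conv' cong: ball_cong)
qed

lemma (in wf_digraph) strongly_connected_iff:
  "strongly_connected G \<longleftrightarrow> verts G \<noteq> {} \<and> connected_in (arcs_ends G) (verts G)"
proof -
  have "G \<restriction> verts G = G" by (rule induce_eq_iff_induced[OF induced_subgraph_refl])
  with strongly_connected_induce_iff[of "verts G"] show ?thesis by simp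
qed

lemma arcs_mk_symmetric_conv: "parcs (mk_symmetric G) = arcs_ends G \<union> (arcs_ends G)\<inverse>"
  by (auto simp: parcs_mk_symmetric arcs_ends_conv)

lemma (in wf_digraph) connected_iff:
  "connected G \<longleftrightarrow> verts G \<noteq> {} \<and> connected_in (arcs_ends G \<union> (arcs_ends G)\<inverse>) (verts G)"
proof -
  interpret S: pair_wf_digraph "mk_symmetric G" ..
  show ?thesis using S.strongly_connected_iff
    by (simp add: connected_def arcs_mk_symmetric_conv)
qed

text \<open>Under symmetry both notions of connectivity agree on vertex sets, so both families are
  induced by the same maximal sets. This makes the theory of \<open>sccs\<close> available for
  counting components.\<close>

lemma (in pseudo_graph) components_eq_sccs: "components G = sccs"
proof -
  let ?Q = "\<lambda>X. X \<noteq> {} \<and> connected_in (arcs_ends G) X"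
  have sym: "sym (arcs_ends G)" using sym_arcs by (simp add: symmetric_def)
  have conv: "connected (G \<restriction> X) \<longleftrightarrow> ?Q X" for X
  proof -
    interpret X: wf_digraph "G \<restriction> X" by rule
    have "arcs_ends (G \<restriction> X) \<union> (arcs_ends (G \<restriction> X))\<inverse> = Restr (arcs_ends G) X"
      using sym by (auto simp: arcs_ends_conv dest: symD)
    then show ?thesis by (simp add: X.connected_iff connected_in_Restr)
  qed
  have "components G = {G \<restriction> X | X. maximal_in ?Q (verts G) X}"
    unfolding components_def
  proof (rule max_subgraphs_eq_induce_maximal)
    fix H assume H: "subgraph H G" "connected H"
    then interpret H: wf_digraph H by auto
    have "arcs_ends H \<union> (arcs_ends H)\<inverse> \<subseteq> arcs_ends G"
      using arcs_ends_mono[OF H(1)] sym by (auto dest: symD)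
    with H show "?Q (verts H)" by (auto simp: H.connected_iff intro: connected_in_mono)
  qed (auto simp: maximal_in_def conv)
  also have "\<dots> = sccs"
    unfolding sccs_altdef2
  proof (rule max_subgraphs_eq_induce_maximal[symmetric])
    fix H assume H: "subgraph H G" "strongly_connected H"
    then interpret H: wf_digraph H by auto
    from H show "?Q (verts H)"
      using arcs_ends_mono[OF H(1)] by (auto simp: H.strongly_connected_iff intro: connected_in_mono)
  qed (auto simp: maximal_in_def strongly_connected_induce_iff)
  finally show ?thesis .
qed

text \<open>The bound is \<le> 1 because the empty graph, left after deleting an only vertex, is
  \<open>connected_in\<close> but has no component.\<close>

lemma (in pseudo_graph) card_components_le_1_iff:
  "card (components G) \<le> 1 \<longleftrightarrow> connected_in (arcs_ends G) (verts G)"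
proof
  \<comment> \<open>An infinite set would also have \<open>card\<close> 0; finiteness comes from the
    injective passage to vertex sets.\<close>
  have fin: "finite sccs" using finite_sccs_verts
    by (simp add: sccs_verts_conv finite_image_iff inj_on_verts_sccs)
  assume "card (components G) \<le> 1"
  then consider "sccs = {}" | c where "sccs = {c}"
    using fin by (auto simp: components_eq_sccs card_le_Suc0_iff_eq)
  then show "connected_in (arcs_ends G) (verts G)"
  proof cases
    case 1
    then have "verts G = {}" using exists_scc by auto
    then show ?thesis by (simp add: connected_in_def)
  next
    case 2
    then have "c \<in> sccs" by simp
    then have "subgraph c G" by (auto intro: induced_imp_subgraph in_sccs_imp_induced)
    \<comment> \<open>The union of one component is that component, while the union of all of
      \<open>sccs\<close> is \<open>G\<close>; hence \<open>c = G\<close>.\<close>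
    then have "Union {c} = c"
      by (intro pre_digraph.equality) (auto simp: Union_def subgraph_def compatible_def)
    then have "c = G" using graph_is_union_sccs 2 by simp
    with 2 show ?thesis using strongly_connected_eq_iff strongly_connected_iff by simp
  qed
next
  assume conn: "connected_in (arcs_ends G) (verts G)"
  show "card (components G) \<le> 1"
  proof (cases "verts G = {}")
    case True
    then have "sccs = {}" by (auto simp: sccs_def strongly_connected_def dest!: induced_imp_subgraph)
    then show ?thesis by (simp add: components_eq_sccs)
  next
    case False
    with conn have "sccs = {G}" using strongly_connected_eq_iff strongly_connected_iff by simp
    then show ?thesis by (simp add: components_eq_sccs)
  qed
qed

text \<open>A connected graph has exactly one component, so \<open>v\<close> is no cut vertex iff
  deleting it leaves at most one, that is, a connected vertex set. For \<open>v\<close> outside the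
  graph, \<open>verts G - {v}\<close> is \<open>verts G\<close> itself.\<close>

lemma (in graph) biconnected_iff:
  "biconnected G \<longleftrightarrow> verts G \<noteq> {} \<and> biconnected_in (arcs_ends G) (verts G)"
proof -
  let ?E = "arcs_ends G" and ?V = "verts G"
  have "?E \<union> ?E\<inverse> = ?E" using sym_arcs by (auto simp: symmetric_def dest: symD)
  then have conn: "connected G \<longleftrightarrow> ?V \<noteq> {} \<and> connected_in ?E ?V" by (simp add: connected_iff)
  have cut: "\<not> cut_vertex G v \<longleftrightarrow> connected_in ?E (?V - {v})" if "connected G" "v \<in> ?V" for v
  proof -
    \<comment> \<open>Deletion passes to an induced subgraph, which stays finite and symmetric, so
      components can be counted there as well.\<close>
    have del: "del_vert v = G \<restriction> (?V - {v})"
      by (auto simp: del_vert_def induce_subgraph_def)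
    have ind: "induced_subgraph (G \<restriction> (?V - {v})) G" by (rule induced_induce) auto
    interpret X: sym_digraph "G \<restriction> (?V - {v})" using ind by (rule induced_graph_imp_graph)
    interpret X: fin_digraph "G \<restriction> (?V - {v})" by (rule fin_digraph_subgraph) (use ind in auto)
    interpret X: pseudo_graph "G \<restriction> (?V - {v})" ..
    have "strongly_connected G" using that conn strongly_connected_iff by simp
    then have "card (components G) = 1"
      by (simp add: components_eq_sccs strongly_connected_eq_iff)
    then have "\<not> cut_vertex G v \<longleftrightarrow> card (components (G \<restriction> (?V - {v}))) \<le> 1"
      using that by (auto simp: cut_vertex_def del)
    moreover have "arcs_ends (G \<restriction> (?V - {v})) = Restr ?E (?V - {v})"
      by (auto simp: arcs_ends_conv)
    ultimately show ?thesis using X.card_components_le_1_iff by (simp add: connected_in_Restr)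
  qed
  have "graph G" by unfold_locales
  moreover have "\<not> cut_vertex G v" if "v \<notin> ?V" for v using that by (simp add: cut_vertex_def)
  ultimately show ?thesis
    using conn cut by (simp add: biconnected_def biconnected_in_def) (metis Diff_empty Diff_insert0)
qed

lemma (in digraph) graph_mk_symmetric: "graph (with_proj (mk_symmetric G))"
proof -
  interpret S: pair_digraph "mk_symmetric G" ..
  show ?thesis by (rule S.graphI) (rule symmetric_mk_symmetric)
qed

lemma (in digraph) biconnected_mk_symmetric_iff:
  "biconnected (with_proj (mk_symmetric G)) \<longleftrightarrow>
    verts G \<noteq> {} \<and> biconnected_in (arcs_ends G \<union> (arcs_ends G)\<inverse>) (verts G)"
  using graph.biconnected_iff[OF graph_mk_symmetric] by (simp add: arcs_mk_symmetric_conv)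

section \<open>Comparison of the two families of components\<close>

theorem theorem8:
  fixes D :: "'a pair_pre_digraph"
  assumes "pair_digraph D"
    and "strongly_connected (with_proj D)"
  shows "strongly_biconnected_components (with_proj D) =
    {with_proj D \<restriction> verts B | B. B \<in> biconnected_components (with_proj (mk_symmetric (with_proj D)))}"
proof -
  interpret D: pair_digraph D by fact
  let ?E = "parcs D" and ?V = "pverts D" and ?U = "with_proj (mk_symmetric (with_proj D))"
  let ?R = "?E \<union> ?E\<inverse>"
  let ?Q = "\<lambda>X. X \<noteq> {} \<and> biconnected_in ?R X"
  interpret U: graph ?U by (rule D.graph_mk_symmetric)
  have U: "verts ?U = ?V" "arcs_ends ?U = ?R" "arcs ?U = ?R"
    by (simp_all add: arcs_mk_symmetric_conv)
  \<comment> \<open>Strong connectivity of \<open>D\<close> enters here and passes to every maximal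
    \<open>?Q\<close>-set.\<close>
  have "connected_in ?E ?V" using assms(2) D.strongly_connected_iff by simp
  then have conn: "connected_in ?E X" if "maximal_in ?Q ?V X" for X
    using connected_in_maximal_biconnected_in[OF that] D.wellformed' by fast
  have "biconnected_components ?U = {?U \<restriction> X | X. maximal_in ?Q (verts ?U) X}"
    unfolding biconnected_components_def
  proof (rule U.max_subgraphs_eq_induce_maximal)
    fix H assume H: "subgraph H ?U" "biconnected H"
    then interpret H: graph H by (simp add: biconnected_def)
    \<comment> \<open>\<open>H\<close> may miss edges between its vertices, but biconnectedness
      survives adding them.\<close>
    have "arcs_ends H \<subseteq> ?R" using arcs_ends_mono[OF H(1)] U by simp
    with H show "?Q (verts H)" by (auto simp: H.biconnected_iff intro: biconnected_in_mono)
  next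
    fix X assume X: "maximal_in ?Q (verts ?U) X"
    then have ind: "induced_subgraph (?U \<restriction> X) ?U"
      by (intro U.induced_induce) (simp add: maximal_in_def)
    interpret X: digraph "?U \<restriction> X" using ind by (rule U.digraphI_induced)
    interpret X: graph "?U \<restriction> X"
      by (rule X.graphI) (rule induced_graph_imp_symmetric[OF U.sym_arcs ind])
    have "arcs_ends (?U \<restriction> X) = Restr ?R X"
      using U by (auto simp: arcs_ends_conv)
    with X show "biconnected (?U \<restriction> X)"
      by (simp add: X.biconnected_iff biconnected_in_Restr maximal_in_def)
  qed simp
  \<comment> \<open>Since \<open>?U \<restriction> X\<close> has vertex set \<open>X\<close>,
    restricting \<open>D\<close> to \<open>verts B\<close> recovers the maximal set behind
    \<open>B\<close>.\<close>
  then have "{with_proj D \<restriction> verts B | B. B \<in> biconnected_components ?U}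
    = {with_proj D \<restriction> X | X. maximal_in ?Q ?V X}" by (auto simp: U) (metis induce_subgraph_verts)
  also have "\<dots> = strongly_biconnected_components (with_proj D)"
    unfolding strongly_biconnected_components_def
  \<comment> \<open>The same \<open>?Q\<close> serves here: from a subgraph it keeps only the
    biconnected half, and for a maximal set \<open>conn\<close> supplies the strong
    connectivity.\<close>
  proof (rule D.max_subgraphs_eq_induce_maximal[symmetric])
    fix H assume H: "subgraph H (with_proj D)" "strongly_biconnected H"
    then interpret H: digraph H by (intro D.digraph_subgraph)
    have "arcs_ends H \<union> (arcs_ends H)\<inverse> \<subseteq> ?R" using arcs_ends_mono[OF H(1)] by auto
    with H show "?Q (verts H)"
      by (auto simp: strongly_biconnected_def H.biconnected_mk_symmetric_iff intro: biconnected_in_mono)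
  next
    fix X assume X: "maximal_in ?Q ?V X"
    then have ind: "induced_subgraph (with_proj D \<restriction> X) (with_proj D)"
      by (intro D.induced_induce) (simp add: maximal_in_def)
    interpret X: digraph "with_proj D \<restriction> X" using ind by (rule D.digraphI_induced)
    have "arcs_ends (with_proj D \<restriction> X) \<union> (arcs_ends (with_proj D \<restriction> X))\<inverse> = Restr ?R X"
      by (auto simp: arcs_ends_conv)
    with X conn[OF X] show "strongly_biconnected (with_proj D \<restriction> X)"
      by (simp add: strongly_biconnected_def D.strongly_connected_induce_iff
        X.biconnected_mk_symmetric_iff biconnected_in_Restr maximal_in_def)
  qed simp
  finally show ?thesis by simp
qed

end
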